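(* Let $S\subseteq\mathbb{N}^d$ be a simplicial, fully embedded affine semigroup with extremal rays $\mathbf{a}_1,\dots,\mathbf{a}_d$, let $E=\{\mathbf{a}_1,\dots,\mathbf{a}_d\}$, and let $\max_{\preceq_S}\mathrm{Ap}(S,E)=\{\mathbf{m}_1,\dots,\mathbf{m}_t\}$. Then $$\mathrm{tr}(S)=\{\mathbf{b}\in S : \text{there exists } 1\le i\le t \text{ such that } \mathbf{b}+\mathbf{m}_i-\mathbf{m}_j\in S \text{ for all } j=1,\dots,t\}.$$
   Context: Setting: $\mathbb{N}$ contains $0$. $S\subseteq\mathbb{N}^d$ ($d\ge 1$) is an affine semigroup minimally generated by $\mathbf{a}_1,\dots,\mathbf{a}_{d+r}$, simplicial and fully embedded in $\mathbb{N}^d$ with extremal rays $\mathbf{a}_1,\dots,\mathbf{a}_d$: the vectors $\mathbf{a}_1,\dots,\mathbf{a}_d$ are linearly independent and $S\subseteq\sum_{i=1}^d\mathbb{Q}_{\ge0}\mathbf{a}_i$. Moreover each $\mathbf{a}_i$ ($1\le i\le d$) is the smallest generator on its extremal ray: if another generator $\mathbf{a}_j=q\mathbf{a}_i$ with $0\neq q\in\mathbb{Q}$, then $q>1$. $\mathrm{group}(S)=\{\mathbf{a}-\mathbf{b}:\mathbf{a},\mathbf{b}\in S\}$. $\mathrm{Ap}(S,E)=\{\mathbf{a}\in S : \mathbf{a}-\mathbf{a}_i\notin S \text{ for all } i=1,\dots,d\}$ (a finite set), and $\mathbf{b}\preceq_S\mathbf{a}$ iff $\mathbf{a}-\mathbf{b}\in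 S$. $\mathrm{QF}(S)=\{\mathbf{m}-\sum_{i=1}^d\mathbf{a}_i : \mathbf{m}\in\max_{\preceq_S}\mathrm{Ap}(S,E)\}$ and $\omega_S=\{-\mathbf{f}:\mathbf{f}\in\mathrm{QF}(S)\}+S$. For $H\subseteq\mathrm{group}(S)$, $H^{-1}=\{\mathbf{z}\in\mathrm{group}(S): \mathbf{z}+H\subseteq S\}$. The trace of $S$ is $\mathrm{tr}(S)=\omega_S+\omega_S^{-1}$ (sum of sets); when $\mathbb{K}[S]$ is Cohen-Macaulay ($\mathbb{K}$ a field) it is the set of exponents of the monomials in the trace ideal of the canonical module $\mathbb{K}[\omega_S]$ of $\mathbb{K}[S]$. *)

theory Defs
  imports "HOL-Analysis.Cartesian_Space" "HOL-Library.Set_Algebras"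
begin

text \<open>The ambient lattice is \<^typ>\<open>int ^ 'd\<close>, with the dimension \<open>d = CARD('d)\<close>; subsets of
  \<open>\<nat>\<^sup>d\<close> are sets of vectors with nonnegative entries, so that differences of vectors
  are genuine (not truncated).\<close>

definition nat_vecs :: "(int ^ 'd) set" where
  "nat_vecs = {v. \<forall>k. 0 \<le> v $ k}"

definition rat_vec :: "int ^ 'd \<Rightarrow> rat ^ 'd" where
  "rat_vec v = (\<chi> k. rat_of_int (v $ k))"

definition nat_span :: "(nat \<Rightarrow> int ^ 'd) \<Rightarrow> nat set \<Rightarrow> (int ^ 'd) set" where
  "nat_span a J = {\<Sum>j\<in>J. int (c j) *s a j | c :: nat \<Rightarrow> nat. True}"

definition minimally_generated :: "(int ^ 'd) set \<Rightarrow> (nat \<Rightarrow> int ^ 'd) \<Rightarrow> nat \<Rightarrow> bool" where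
  "minimally_generated S a n \<longleftrightarrow>
     S = nat_span a {1..n} \<and> (\<forall>J. J \<subset> {1..n} \<longrightarrow> nat_span a J \<noteq> S)"

text \<open>The minimal generators are \<open>a 1, \<dots>, a (d + r)\<close> and the extremal rays are the first \<open>d\<close>
  of them. \<^const>\<open>vec.independent\<close> is a property of sets, hence the injectivity clause.\<close>

definition simplicial_fully_embedded ::
    "(int ^ 'd) set \<Rightarrow> (nat \<Rightarrow> int ^ 'd) \<Rightarrow> nat \<Rightarrow> bool" where
  "simplicial_fully_embedded S a r \<longleftrightarrow>
     S \<subseteq> nat_vecs \<and>
     minimally_generated S a (CARD('d) + r) \<and>
     inj_on a {1..CARD('d)} \<and>
     vec.independent ((\<lambda>i. rat_vec (a i)) ` {1..CARD('d)}) \<and>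
     (\<forall>s\<in>S. \<exists>q :: nat \<Rightarrow> rat. (\<forall>i\<in>{1..CARD('d)}. 0 \<le> q i) \<and>
        rat_vec s = (\<Sum>i=1..CARD('d). q i *s rat_vec (a i))) \<and>
     (\<forall>i\<in>{1..CARD('d)}. \<forall>j\<in>{1..CARD('d) + r}. \<forall>q :: rat.
        j \<noteq> i \<and> q \<noteq> 0 \<and> rat_vec (a j) = q *s rat_vec (a i) \<longrightarrow> 1 < q)"

definition extremal_rays :: "(nat \<Rightarrow> int ^ 'd) \<Rightarrow> (int ^ 'd) set" where
  "extremal_rays a = a ` {1..CARD('d)}"

definition semigroup_group :: "(int ^ 'd) set \<Rightarrow> (int ^ 'd) set" where
  "semigroup_group S = {x - y | x y. x \<in> S \<and> y \<in> S}"

definition semigroup_le :: "(int ^ 'd) set \<Rightarrow> int ^ 'd \<Rightarrow> int ^ 'd \<Rightarrow> bool" where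
  "semigroup_le S x y \<longleftrightarrow> y - x \<in> S"

definition Apery :: "(int ^ 'd) set \<Rightarrow> (int ^ 'd) set \<Rightarrow> (int ^ 'd) set" where
  "Apery S E = {x \<in> S. \<forall>e\<in>E. x - e \<notin> S}"

definition max_Apery :: "(int ^ 'd) set \<Rightarrow> (int ^ 'd) set \<Rightarrow> (int ^ 'd) set" where
  "max_Apery S E = {m \<in> Apery S E. \<forall>x\<in>Apery S E. semigroup_le S m x \<longrightarrow> x = m}"

definition quasi_Frobenius :: "(int ^ 'd) set \<Rightarrow> (int ^ 'd) set \<Rightarrow> (int ^ 'd) set" where
  "quasi_Frobenius S E = (\<lambda>m. m - \<Sum>E) ` max_Apery S E"

text \<open>Below, \<open>+\<close> on sets is the elementwise (Minkowski) sum from \<^theory>\<open>HOL-Library.Set_Algebras\<close>.\<close>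

definition canonical_ideal :: "(int ^ 'd) set \<Rightarrow> (int ^ 'd) set \<Rightarrow> (int ^ 'd) set" where
  "canonical_ideal S E = uminus ` quasi_Frobenius S E + S"

definition ideal_inverse :: "(int ^ 'd) set \<Rightarrow> (int ^ 'd) set \<Rightarrow> (int ^ 'd) set" where
  "ideal_inverse S H = {z \<in> semigroup_group S. \<forall>h\<in>H. z + h \<in> S}"

definition semigroup_trace :: "(int ^ 'd) set \<Rightarrow> (int ^ 'd) set \<Rightarrow> (int ^ 'd) set" where
  "semigroup_trace S E = canonical_ideal S E + ideal_inverse S (canonical_ideal S E)"

end

theory Submission imports Defs begin

text \<open>Write \<open>e\<close> for the sum of the extremal rays, so that \<open>\<omega>\<close> is the union of the translates
  \<open>e - m + S\<close>, where \<open>m\<close> runs through the maximal Apery elements. As \<open>S\<close> is closed under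
  addition, \<open>z\<close> in \<open>group(S)\<close> lies in \<open>\<omega>\<^sup>-\<^sup>1\<close> as soon as \<open>z + (e - m)\<close> lies in \<open>S\<close> for all
  these \<open>m\<close>. The substitution \<open>z = b - (e - m\<^sub>i)\<close> turns \<open>z + (e - m\<^sub>j)\<close> into
  \<open>b + m\<^sub>i - m\<^sub>j\<close>; hence \<open>b\<close> in \<open>S\<close> belongs to \<open>(e - m\<^sub>i) + \<omega>\<^sup>-\<^sup>1\<close> exactly if all \<open>b + m\<^sub>i - m\<^sub>j\<close> lie
  in \<open>S\<close>. An element of the trace is of this form up to a summand in \<open>S\<close>, which \<open>\<omega>\<^sup>-\<^sup>1\<close>
  absorbs.

  The argument holds for every submonoid \<open>S\<close> and every subset \<open>E\<close> of it; this is
  \<open>semigroup_trace_submonoid\<close>. An affine semigroup provides these hypotheses because it is the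
  set of natural combinations of its generators.\<close>

lemma zero_in_nat_span: "0 \<in> nat_span a J"
  unfolding nat_span_def by (rule CollectI, rule exI[of _ "\<lambda>_. 0"]) simp

lemma nat_span_add:
  assumes "x \<in> nat_span a J" "y \<in> nat_span a J"
  shows "x + y \<in> nat_span a J"
proof -
  obtain c c' where "x = (\<Sum>j\<in>J. int (c j) *s a j)" "y = (\<Sum>j\<in>J. int (c' j) *s a j)"
    using assms unfolding nat_span_def by blast
  then have "x + y = (\<Sum>j\<in>J. int (c j + c' j) *s a j)"
    by (simp add: sum.distrib vector_sadd_rdistrib)
  then show ?thesis
    unfolding nat_span_def by (intro CollectI exI[of _ "\<lambda>j. c j + c' j"]) simp
qed

lemma generator_in_nat_span:
  assumes "finite J" "i \<in> J"
  shows "a i \<in> nat_span a J"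
proof -
  have "(\<Sum>j\<in>J. int (if j = i then 1 else 0) *s a j) = (\<Sum>j\<in>J. if j = i then a j else 0)"
    by (rule sum.cong) auto
  also have "\<dots> = a i"
    using assms by simp
  finally show ?thesis
    unfolding nat_span_def by (intro CollectI exI[of _ "\<lambda>j. if j = i then 1 else 0"]) simp
qed

lemma sum_in_submonoid:
  fixes S :: "'a :: comm_monoid_add set"
  assumes "0 \<in> S" "\<And>x y. x \<in> S \<Longrightarrow> y \<in> S \<Longrightarrow> x + y \<in> S" "E \<subseteq> S"
  shows "\<Sum>E \<in> S"
  using assms(3) by (induction E rule: infinite_finite_induct) (auto intro: assms(1,2))

lemma canonical_ideal_eq:
  "canonical_ideal S E = {\<Sum>E - m + s | m s. m \<in> max_Apery S E \<and> s \<in> S}"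
  unfolding canonical_ideal_def quasi_Frobenius_def set_plus_def by force

text \<open>Adding elements of \<open>S\<close> does not lead out of \<open>S\<close>, so the generators
  \<open>\<Sum>E - m\<close> of the canonical ideal decide which \<open>z\<close> lie in its inverse.\<close>

lemma ideal_inverse_canonical_ideal_iff:
  assumes zero: "0 \<in> S" and add: "\<And>x y. x \<in> S \<Longrightarrow> y \<in> S \<Longrightarrow> x + y \<in> S"
  shows "z \<in> ideal_inverse S (canonical_ideal S E) \<longleftrightarrow>
    z \<in> semigroup_group S \<and> (\<forall>m\<in>max_Apery S E. z + (\<Sum>E - m) \<in> S)" (is "?L \<longleftrightarrow> ?R")
proof
  assume ?L
  moreover have "\<Sum>E - m \<in> canonical_ideal S E" if "m \<in> max_Apery S E" for m
    unfolding canonical_ideal_eq using that zero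
    by (intro CollectI exI[of _ m] exI[of _ 0]) simp
  ultimately show ?R
    unfolding ideal_inverse_def by blast
next
  assume R: ?R
  have "z + (\<Sum>E - m + s) \<in> S" if "m \<in> max_Apery S E" "s \<in> S" for m s
    using add[of "z + (\<Sum>E - m)" s] R that by (simp add: add.assoc)
  with R show ?L
    unfolding ideal_inverse_def canonical_ideal_eq by blast
qed

lemma semigroup_trace_submonoid:
  assumes zero: "0 \<in> S" and add: "\<And>x y. x \<in> S \<Longrightarrow> y \<in> S \<Longrightarrow> x + y \<in> S"
    and "E \<subseteq> S"
  shows "semigroup_trace S E =
    {b \<in> S. \<exists>m\<in>max_Apery S E. \<forall>m'\<in>max_Apery S E. b + m - m' \<in> S}" (is "_ = ?R")
proof (intro equalityI subsetI)
  fix b assume "b \<in> semigroup_trace S E"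
  then obtain h z where h: "h \<in> canonical_ideal S E"
    and z: "z \<in> ideal_inverse S (canonical_ideal S E)" and b: "b = h + z"
    unfolding semigroup_trace_def by (blast elim: set_plus_elim)
  from h obtain m s where m: "m \<in> max_Apery S E" and "s \<in> S" and h_eq: "h = \<Sum>E - m + s"
    unfolding canonical_ideal_eq by blast
  have "b + m - m' \<in> S" if "m' \<in> max_Apery S E" for m'
  proof -
    have "z + (\<Sum>E - m') \<in> S"
      using z that ideal_inverse_canonical_ideal_iff[OF zero add] by blast
    moreover have "b + m - m' = z + (\<Sum>E - m') + s"
      by (simp add: b h_eq)
    ultimately show ?thesis
      using add \<open>s \<in> S\<close> by metis
  qed
  moreover have "b \<in> S"
    using z h unfolding b ideal_inverse_def by (simp add: add.commute)
  ultimately show "b \<in> ?R"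
    using m by blast
next
  fix b assume "b \<in> ?R"
  then obtain m where "b \<in> S" and m: "m \<in> max_Apery S E"
    and diff: "\<And>m'. m' \<in> max_Apery S E \<Longrightarrow> b + m - m' \<in> S"
    by blast
  define z where "z = b + m - \<Sum>E"
  have "m \<in> S"
    using m by (simp add: max_Apery_def Apery_def)
  then have "z \<in> semigroup_group S"
    unfolding semigroup_group_def z_def
    using add[OF \<open>b \<in> S\<close>] sum_in_submonoid[OF zero add \<open>E \<subseteq> S\<close>] by blast
  moreover have "z + (\<Sum>E - m') \<in> S" if "m' \<in> max_Apery S E" for m'
    using diff[OF that] by (simp add: z_def add_diff_eq)
  ultimately have "z \<in> ideal_inverse S (canonical_ideal S E)"
    using ideal_inverse_canonical_ideal_iff[OF zero add] by blast
  moreover have "\<Sum>E - m \<in> canonical_ideal S E"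
    unfolding canonical_ideal_eq using m zero
    by (intro CollectI exI[of _ m] exI[of _ 0]) simp
  moreover have "b = (\<Sum>E - m) + z"
    by (simp add: z_def)
  ultimately show "b \<in> semigroup_trace S E"
    unfolding semigroup_trace_def by (metis set_plus_intro)
qed

theorem proposition1p5:
  fixes S :: "(int ^ 'd) set" and a :: "nat \<Rightarrow> int ^ 'd" and r :: nat
    and m :: "nat \<Rightarrow> int ^ 'd" and t :: nat
  assumes "simplicial_fully_embedded S a r"
    and "max_Apery S (extremal_rays a) = m ` {1..t}"
  shows "semigroup_trace S (extremal_rays a) =
    {b \<in> S. \<exists>i\<in>{1..t}. \<forall>j\<in>{1..t}. b + m i - m j \<in> S}"
proof -
  have S: "S = nat_span a {1..CARD('d) + r}"
    using assms(1) by (simp add: simplicial_fully_embedded_def minimally_generated_def)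
  have "0 \<in> S" and "\<And>x y. x \<in> S \<Longrightarrow> y \<in> S \<Longrightarrow> x + y \<in> S"
    unfolding S by (fact zero_in_nat_span, fact nat_span_add)
  moreover have "extremal_rays a \<subseteq> S"
    unfolding S extremal_rays_def by (auto intro!: generator_in_nat_span)
  ultimately show ?thesis
    using semigroup_trace_submonoid[of S "extremal_rays a"] assms(2) by simp
qed

end
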